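(* Let $M\in\mathbb{N}$ and let $(X_n)_{n\in\mathbb{N}}$ be an $M$-batch jittered sampling sequence. Then $(X_n)_{n\in\mathbb{N}}$ almost surely has Poissonian pair correlations.
   Context: A jittered sample of size $M$ is a random tuple $(X_1,\ldots,X_M)$ in $[0,1)$ given by $X_n=\frac{\pi(n)-1+Y_n}{M}$ for $1\le n\le M$, where $\pi$ is a uniformly random permutation of $\{1,\ldots,M\}$, $Y_1,\ldots,Y_M$ are uniformly distributed on $[0,1)$, and $\pi,Y_1,\ldots,Y_M$ are independent. A random sequence $(X_n)_{n\in\mathbb{N}}$ is an $M$-batch jittered sampling sequence if for each $j\in\mathbb{N}_0$ the batch $X^{(j)}=(X_{jM+1},\ldots,X_{jM+M})$ is a jittered sample of size $M$ and the random batches $X^{(0)},X^{(1)},X^{(2)},\ldots$ are independent. $\|\cdot\|$ denotes the distance of a real number to its closest integer. A sequence $(x_n)_{n\in\mathbb{N}}$ in $[0,1)$ has Poissonian pair correlations (PPC) if for all $s\ge 0$ $$\lim_{N\to\infty}\frac1N\,\#\left\{(i,j): 1\le i\ne j\le N,\ \|x_i-x_j\|\le \frac{s}{N}\right\}=2s.$$ *)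

theory Defs
  imports "HOL-Probability.Probability"
begin

definition dist_nearest_int :: "real \<Rightarrow> real" where
  "dist_nearest_int x = \<bar>x - of_int (round x)\<bar>"

text \<open>Sequences are indexed by the positive integers; the value at index 0 is never used.\<close>

definition poissonian_pair_correlations :: "(nat \<Rightarrow> real) \<Rightarrow> bool" where
  "poissonian_pair_correlations x \<longleftrightarrow>
    (\<forall>s\<ge>0. (\<lambda>N. real (card {(i, j). i \<in> {1..N} \<and> j \<in> {1..N} \<and> i \<noteq> j \<and>
                                dist_nearest_int (x i - x j) \<le> s / real N}) / real N)
            \<longlonglongrightarrow> 2 * s)"

text \<open>
  The permutation and the offsets have different value types, so their joint independence is
  stated with \<^const>\<open>prob_space.indep_sets\<close> for the generated sigma-algebras: index \<^const>\<open>None\<close>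
  belongs to \<open>\<pi>\<close>, index \<open>Some n\<close> to \<open>Y n\<close>.

  The defining equation is required only almost surely. A random tuple therefore is a jittered
  sample as soon as it has the right distribution, because \<open>\<pi>\<close> and \<open>Y\<close> can be recovered from
  \<open>X\<close> by \<open>\<pi> n - 1 = floor (M * X n)\<close> and \<open>Y n = frac (M * X n)\<close> outside a null set.
\<close>

definition jittered_sample :: "'a measure \<Rightarrow> nat \<Rightarrow> (nat \<Rightarrow> 'a \<Rightarrow> real) \<Rightarrow> bool" where
  "jittered_sample P M X \<longleftrightarrow>
    (\<forall>n\<in>{1..M}. X n \<in> borel_measurable P) \<and>
    (\<exists>(\<pi> :: 'a \<Rightarrow> nat \<Rightarrow> nat) (Y :: nat \<Rightarrow> 'a \<Rightarrow> real).
      \<pi> \<in> measurable P (count_space {p. p permutes {1..M}}) \<and>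
      distr P (count_space {p. p permutes {1..M}}) \<pi> = uniform_count_measure {p. p permutes {1..M}} \<and>
      (\<forall>n\<in>{1..M}. Y n \<in> borel_measurable P \<and>
                   distr P borel (Y n) = uniform_measure lborel {0..<1}) \<and>
      prob_space.indep_sets P
        (\<lambda>k. case k of
               None \<Rightarrow> {\<pi> -` A \<inter> space P | A. A \<in> sets (count_space {p. p permutes {1..M}})}
             | Some n \<Rightarrow> {Y n -` A \<inter> space P | A. A \<in> sets borel})
        (insert None (Some ` {1..M})) \<and>
      (\<forall>n\<in>{1..M}. AE \<omega> in P. X n \<omega> = (real (\<pi> \<omega> n) - 1 + Y n \<omega>) / real M))"

definition batch_jittered_sequence :: "'a measure \<Rightarrow> nat \<Rightarrow> (nat \<Rightarrow> 'a \<Rightarrow> real) \<Rightarrow> bool" where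
  "batch_jittered_sequence P M X \<longleftrightarrow>
    (\<forall>j. jittered_sample P M (\<lambda>n. X (j * M + n))) \<and>
    prob_space.indep_vars P (\<lambda>_. \<Pi>\<^sub>M n\<in>{1..M}. borel)
      (\<lambda>j \<omega>. \<lambda>n\<in>{1..M}. X (j * M + n) \<omega>) UNIV"

end

theory Submission
  imports Defs "HOL-Library.Discrete_Functions" "HOL-Real_Asymp.Real_Asymp"
begin

text \<open>
  For a fixed point \<open>x\<close>, the expected number of points of a batch within distance \<open>\<delta> < 1/2\<close> of \<open>x\<close>
  is exactly \<open>2 * \<delta> * M\<close>. Hence the numbers of close pairs between two different batches, once
  centred, are uncorrelated for different pairs of batches, so that for \<open>\<delta> = s / N\<close> the number of
  close pairs across batches has variance \<open>O(N)\<close>. Close pairs inside a batch have expectation \<open>O(1)\<close>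
  in total, because \<open>\<parallel>X i - X j\<parallel> \<le> \<delta>\<close> implies \<open>\<parallel>Y i - Y j\<parallel> \<le> M * \<delta>\<close>. Both
  bounds, divided by the normalisation, are summable along \<open>N = M * k\<^sup>2\<close>, which gives almost sure
  convergence along this subsequence for all rational \<open>s > 0\<close>. Monotonicity of the pair count in \<open>N\<close>
  and in the radius extends it to all \<open>N\<close> and \<open>s\<close>, since consecutive terms of the subsequence have
  ratio tending to 1.
\<close>

section \<open>The circle\<close>

lemma dist_nearest_int_le: "dist_nearest_int x \<le> \<bar>x - of_int k\<bar>"
  unfolding dist_nearest_int_def by (rule round_diff_minimal)

lemma dist_nearest_int_add_int [simp]: "dist_nearest_int (x + of_int k) = dist_nearest_int x"
  by (intro antisym dist_nearest_int_le[THEN order_trans, of _ "round x + k"]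
        dist_nearest_int_le[THEN order_trans, of _ "round (x + of_int k) - k"])
     (auto simp: dist_nearest_int_def)

lemma dist_nearest_int_minus [simp]: "dist_nearest_int (- x) = dist_nearest_int x"
proof -
  have "dist_nearest_int (- y) \<le> dist_nearest_int y" for y
    using dist_nearest_int_le[of "- y" "- round y"] by (simp add: dist_nearest_int_def)
  from this[of x] this[of "- x"] show ?thesis by simp
qed

lemma dist_nearest_int_commute: "dist_nearest_int (x - y) = dist_nearest_int (y - x)"
  using dist_nearest_int_minus[of "x - y"] by simp

text \<open>If \<open>k\<close> is the integer nearest to \<open>x\<close>, then
  \<open>n * k\<close> is an integer at distance \<open>n * \<bar>x - k\<bar>\<close> from
  \<open>n * x\<close>.\<close>

lemma dist_nearest_int_mult_nat_le: "dist_nearest_int (real n * x) \<le> real n * dist_nearest_int x"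
  using dist_nearest_int_le[of "real n * x" "int n * round x"]
  by (simp add: dist_nearest_int_def abs_mult flip: right_diff_distrib)

lemma dist_nearest_int_eq_abs:
  assumes "\<bar>x\<bar> \<le> 1/2" shows "dist_nearest_int x = \<bar>x\<bar>"
proof (rule antisym)
  show "dist_nearest_int x \<le> \<bar>x\<bar>" using dist_nearest_int_le[of x 0] by simp
  have "\<bar>x\<bar> \<le> \<bar>x - of_int k\<bar>" for k :: int
  proof (cases "k = 0")
    case False
    then have "\<bar>real_of_int k\<bar> \<ge> 1" by linarith
    then show ?thesis using assms by linarith
  qed simp
  then show "\<bar>x\<bar> \<le> dist_nearest_int x" by (simp add: dist_nearest_int_def)
qed

lemma borel_measurable_dist_nearest_int [measurable]: "dist_nearest_int \<in> borel_measurable borel"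
  unfolding dist_nearest_int_def[abs_def] round_def by measurable

section \<open>Lebesgue measure on the circle\<close>

lemma emeasure_lborel_affine:
  fixes c t :: real
  assumes "A \<in> sets borel" "c \<noteq> 0"
  shows "emeasure lborel A = ennreal \<bar>c\<bar> * emeasure lborel {x. t + c * x \<in> A}"
proof -
  have "{x. t + c * x \<in> A} \<in> sets borel"
    using assms(1) by measurable
  then show ?thesis
    using nn_integral_real_affine[of "indicator A" c t] assms
    by (simp add: indicator_def of_bool_def cong: if_cong flip: nn_integral_indicator)
qed

text \<open>The interval is cut at the integer \<open>n = \<lceil>a\<rceil>\<close>. Shifting the
  left piece back by \<open>n - 1\<close> and the right piece by \<open>n\<close> produces a
  partition of [0,1).\<close>

lemma emeasure_lborel_periodic:
  fixes Q :: "real \<Rightarrow> bool" and a :: real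
  assumes [measurable]: "Measurable.pred borel Q"
    and per: "\<And>x k. Q (x + of_int k) = Q x"
  shows "emeasure lborel {u \<in> {a..<a+1}. Q u} = emeasure lborel {u \<in> {0..<1}. Q u}"
proof -
  define n where "n = \<lceil>a\<rceil>"
  have n: "a \<le> n" "n < a + 1" by (auto simp: n_def) linarith+
  have "{u \<in> {a..<a+1}. Q u} = {u \<in> {a..<n}. Q u} \<union> {u \<in> {n..<a+1}. Q u}"
    using n by auto
  then have "emeasure lborel {u \<in> {a..<a+1}. Q u} =
      emeasure lborel ({u \<in> {a..<n}. Q u} \<union> {u \<in> {n..<a+1}. Q u})"
    by (rule arg_cong)
  also have "\<dots> = emeasure lborel {u \<in> {a..<n}. Q u} + emeasure lborel {u \<in> {n..<a+1}. Q u}"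
    by (rule plus_emeasure[symmetric]) auto
  also have "emeasure lborel {u \<in> {a..<n}. Q u} = emeasure lborel {u \<in> {a+1-n..<1}. Q u}"
    using per[of _ "n - 1"]
    by (subst emeasure_lborel_affine[where c=1 and t="n - 1"])
       (auto simp: algebra_simps intro!: arg_cong[where f="emeasure lborel"])
  also have "emeasure lborel {u \<in> {n..<a+1}. Q u} = emeasure lborel {u \<in> {0..<a+1-n}. Q u}"
    using per[of _ "n"]
    by (subst emeasure_lborel_affine[where c=1 and t="n"])
       (auto simp: algebra_simps intro!: arg_cong[where f="emeasure lborel"])
  also have "emeasure lborel {u \<in> {a+1-n..<1}. Q u} + emeasure lborel {u \<in> {0..<a+1-n}. Q u}
     = emeasure lborel {u \<in> {0..<1}. Q u}"
    using n by (subst plus_emeasure) (auto intro!: arg_cong[where f="emeasure lborel"])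
  finally show ?thesis .
qed

text \<open>By periodicity the unit interval may be centred at \<open>x\<close>, where the distance
  to the nearest integer is the absolute value. As \<open>\<delta> < 1/2\<close>, the closed ball
  fits into this half-open interval.\<close>

lemma emeasure_circle_ball:
  assumes "0 \<le> \<delta>" "\<delta> < 1/2"
  shows "emeasure lborel {u \<in> {0..<1}. dist_nearest_int (x - u) \<le> \<delta>} = ennreal (2 * \<delta>)"
proof -
  have "emeasure lborel {u \<in> {0..<1}. dist_nearest_int (x - u) \<le> \<delta>}
      = emeasure lborel {u \<in> {x-1/2..<x-1/2+1}. dist_nearest_int (x - u) \<le> \<delta>}"
  proof (rule emeasure_lborel_periodic[symmetric])
    fix y :: real and k :: int
    show "(dist_nearest_int (x - (y + k)) \<le> \<delta>) = (dist_nearest_int (x - y) \<le> \<delta>)"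
      using dist_nearest_int_add_int[of "x - y" "- k"] by (simp add: algebra_simps)
  qed measurable
  also have "{u \<in> {x-1/2..<x-1/2+1}. dist_nearest_int (x - u) \<le> \<delta>} = {x-\<delta>..x+\<delta>}"
  proof -
    have "dist_nearest_int (x - u) = \<bar>x - u\<bar>" if "u \<in> {x-1/2..<x-1/2+1}" for u
      using that by (intro dist_nearest_int_eq_abs abs_leI) auto
    moreover have "u \<in> {x-1/2..<x-1/2+1}" if "u \<in> {x-\<delta>..x+\<delta>}" for u
      using that assms by auto
    ultimately show ?thesis by auto
  qed
  finally show ?thesis using assms by simp
qed

section \<open>The uniform distribution and its strata\<close>

definition unif :: "real measure" where
  "unif = uniform_measure lborel {0..<1}"

lemma sets_unif [measurable_cong]: "sets unif = sets borel"
  by (simp add: unif_def)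

lemma space_unif [simp]: "space unif = UNIV"
  by (simp add: unif_def)

lemma emeasure_unif: "A \<in> sets borel \<Longrightarrow> emeasure unif A = emeasure lborel ({0..<1} \<inter> A)"
  by (simp add: unif_def divide_ennreal_def)

interpretation unif: prob_space unif
  unfolding unif_def by (rule prob_space_uniform_measure) auto

lemma measure_unif_circle_ball:
  assumes "0 \<le> \<delta>" "\<delta> < 1/2"
  shows "measure unif {u. dist_nearest_int (x - u) \<le> \<delta>} = 2 * \<delta>"
proof -
  have "emeasure unif {u. dist_nearest_int (x - u) \<le> \<delta>} = 2 * \<delta>"
    using emeasure_circle_ball[OF assms, of x] by (simp add: emeasure_unif Int_def)
  then show ?thesis using assms by (simp add: unif.emeasure_eq_measure)
qed

text \<open>The map \<open>y \<mapsto> (k - 1 + y) / M\<close> carries [0,1) onto the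
  \<open>k\<close>-th stratum and scales lengths by \<open>1 / M\<close>, and the strata are
  disjoint. The number \<open>K\<close> of strata is kept separate from \<open>M\<close> for the
  induction.\<close>

lemma sum_emeasure_strata:
  fixes Q :: "real \<Rightarrow> bool"
  assumes [measurable]: "Measurable.pred borel Q" and "M > 0"
  shows "(\<Sum>k=1..K. emeasure unif {y. Q ((real k - 1 + y) / real M)})
       = of_nat M * emeasure lborel {u \<in> {0..<real K / real M}. Q u}"
proof (induction K)
  case 0
  then show ?case by simp
next
  case (Suc K)
  let ?A = "{u \<in> {real K / real M..<real (Suc K) / real M}. Q u}"
  have "emeasure unif {y. Q ((real K + y) / real M)} =
      emeasure lborel {y \<in> {0..<1}. Q ((real K + y) / real M)}"
    by (simp add: emeasure_unif Int_def)
  \<comment> \<open>The factor \<open>1 / M\<close> is split off because it is the slope of the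
    affine map from [0,1) onto the stratum.\<close>
  also have "\<dots> = ennreal (real M) * (ennreal (1 / real M) * emeasure lborel {y \<in> {0..<1}. Q ((real K + y) / real M)})"
    using \<open>M > 0\<close> by (simp flip: mult.assoc ennreal_mult)
  also have "ennreal (1 / real M) * emeasure lborel {y \<in> {0..<1}. Q ((real K + y) / real M)} = emeasure lborel ?A"
    using \<open>M > 0\<close>
    by (subst (2) emeasure_lborel_affine[where c="1 / real M" and t="real K / real M"])
       (auto simp: field_simps zero_le_mult_iff intro!: arg_cong2[where f="(*)"] arg_cong[where f="emeasure lborel"])
  finally have *: "emeasure unif {y. Q ((real K + y) / real M)} = of_nat M * emeasure lborel ?A"
    by (simp add: ennreal_of_nat_eq_real_of_nat)
  have "{u \<in> {0..<real (Suc K) / real M}. Q u} = {u \<in> {0..<real K / real M}. Q u} \<union> ?A"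
  proof -
    have "real K / real M \<le> real (Suc K) / real M"
      by (auto intro: divide_right_mono)
    moreover have "0 \<le> u" if "real K / real M \<le> u" for u
      using that by (rule order_trans[rotated]) simp
    ultimately show ?thesis by auto
  qed
  then have "emeasure lborel {u \<in> {0..<real (Suc K) / real M}. Q u} =
     emeasure lborel ({u \<in> {0..<real K / real M}. Q u} \<union> ?A)"
    by (rule arg_cong)
  also have "\<dots> = emeasure lborel {u \<in> {0..<real K / real M}. Q u} + emeasure lborel ?A"
    by (rule plus_emeasure[symmetric]) auto
  finally show ?case using Suc * by (simp add: distrib_left)
qed

text \<open>For \<open>K = M\<close> the strata fill [0,1), so the dependence on \<open>x\<close>
  disappears.\<close>

lemma sum_measure_strata_circle_ball:
  assumes "0 \<le> \<delta>" "\<delta> < 1/2" "M > 0"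
  shows "(\<Sum>k=1..M. measure unif {y. dist_nearest_int (x - (real k - 1 + y) / real M) \<le> \<delta>}) = 2 * \<delta> * real M"
proof -
  have "ennreal (\<Sum>k=1..M. measure unif {y. dist_nearest_int (x - (real k - 1 + y) / real M) \<le> \<delta>})
     = of_nat M * emeasure lborel {u \<in> {0..<real M / real M}. dist_nearest_int (x - u) \<le> \<delta>}"
    using assms by (subst sum_emeasure_strata[symmetric]) (simp_all add: unif.emeasure_eq_measure)
  also have "{0..<real M / real M} = {0..<1}"
    using \<open>M > 0\<close> by simp
  also have "of_nat M * emeasure lborel {u \<in> {0..<1}. dist_nearest_int (x - u) \<le> \<delta>} = ennreal (2 * \<delta> * real M)"
    unfolding emeasure_circle_ball[OF assms(1,2)] using assms(1)
    by (simp add: ennreal_of_nat_eq_real_of_nat mult.commute flip: ennreal_mult)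
  finally show ?thesis using assms by (subst (asm) ennreal_inj) (auto intro: sum_nonneg)
qed

section \<open>Pair counts along a subsequence\<close>

text \<open>The radius is decoupled from \<open>N\<close>, so that the count is monotone in each of
  the two arguments.\<close>

definition pair_count :: "(nat \<Rightarrow> real) \<Rightarrow> nat \<Rightarrow> real \<Rightarrow> nat" where
  "pair_count x N r =
    card {(i, j). i \<in> {1..N} \<and> j \<in> {1..N} \<and> i \<noteq> j \<and> dist_nearest_int (x i - x j) \<le> r}"

lemma pair_count_mono:
  assumes "N \<le> N'" "r \<le> r'"
  shows "pair_count x N r \<le> pair_count x N' r'"
  unfolding pair_count_def
proof (rule card_mono)
  show "finite {(i, j). i \<in> {1..N'} \<and> j \<in> {1..N'} \<and> i \<noteq> j \<and> dist_nearest_int (x i - x j) \<le> r'}"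
    by (rule finite_subset[of _ "{1..N'} \<times> {1..N'}"]) auto
qed (use assms in auto)

text \<open>\<open>N\<close> is sandwiched between consecutive values of
  \<open>M * k\<^sup>2\<close>, and \<open>s\<close> is replaced by a rational \<open>t\<close>
  slightly below or above it. The gap between \<open>t\<close> and \<open>s\<close> absorbs the
  change of radius, the gap between \<open>2 * t\<close> and \<open>a\<close> the change of
  normalisation.\<close>

lemma poissonian_pair_correlations_subseq:
  fixes M :: nat
  assumes "M > 0"
    and lim: "\<And>t. t \<in> \<rat> \<Longrightarrow> t > 0 \<Longrightarrow>
      (\<lambda>k. real (pair_count x (M * k\<^sup>2) (t / real (M * k\<^sup>2))) / real (M * k\<^sup>2)) \<longlonglongrightarrow> 2 * t"
  shows "poissonian_pair_correlations x"
proof -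
  define L where "L k = M * k\<^sup>2" for k
  \<comment> \<open>\<open>\<kappa> N\<close> is the largest \<open>k\<close> with
    \<open>L k \<le> N\<close>. For \<open>N < M\<close> it is 0, and then \<open>\<rho> N\<close>
    is 0 by division by zero; the estimates below are therefore restricted to large
    \<open>N\<close>.\<close>
  define \<kappa> where "\<kappa> N = floor_sqrt (N div M)" for N
  define \<rho> where "\<rho> N = real (L (Suc (\<kappa> N))) / real (L (\<kappa> N))" for N
  define c where "c t k = real (pair_count x (L k) (t / real (L k))) / real (L k)" for t k
  have c_lim: "c t \<longlonglongrightarrow> 2 * t" if "t \<in> \<rat>" "t > 0" for t
    using lim[OF that] by (simp add: c_def[abs_def] L_def)
  have L_le: "L (\<kappa> N) \<le> N" for N
  proof -
    have "L (\<kappa> N) \<le> M * (N div M)"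
      by (simp add: L_def \<kappa>_def)
    also have "\<dots> \<le> N" by (rule times_div_less_eq_dividend)
    finally show ?thesis .
  qed
  have le_L: "N \<le> L (Suc (\<kappa> N))" for N
  proof -
    have "Suc (N div M) \<le> (Suc (\<kappa> N))\<^sup>2"
      unfolding \<kappa>_def using Suc_floor_sqrt_power2_gt by (simp add: Suc_le_eq)
    then have "M * Suc (N div M) \<le> L (Suc (\<kappa> N))"
      unfolding L_def by (rule mult_le_mono2)
    moreover have "N < M * Suc (N div M)"
      using \<open>M > 0\<close> dividend_less_times_div[of M N] by simp
    ultimately show ?thesis by simp
  qed
  have \<kappa>_top: "filterlim \<kappa> at_top sequentially"
    unfolding filterlim_at_top
  proof
    fix Z
    show "\<forall>\<^sub>F N in sequentially. Z \<le> \<kappa> N"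
      using eventually_ge_at_top[of "M * Z\<^sup>2"]
    proof eventually_elim
      case (elim N)
      then have "Z\<^sup>2 \<le> N div M" using \<open>M > 0\<close>
        by (metis div_le_mono nonzero_mult_div_cancel_left not_gr_zero)
      then show ?case by (simp add: \<kappa>_def le_floor_sqrtI)
    qed
  qed
  then have Suc_\<kappa>_top: "filterlim (\<lambda>N. Suc (\<kappa> N)) at_top sequentially"
    by (rule filterlim_compose[OF filterlim_Suc])
  have "(\<lambda>k. real (L (Suc k)) / real (L k)) \<longlonglongrightarrow> 1"
  proof -
    have "(\<lambda>k::nat. (real k + 1)\<^sup>2 / (real k)\<^sup>2) \<longlonglongrightarrow> 1"
      by real_asymp
    then show ?thesis using \<open>M > 0\<close> by (simp add: L_def add.commute)
  qed
  from filterlim_compose[OF this \<kappa>_top] have \<rho>_lim: "\<rho> \<longlonglongrightarrow> 1"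
    by (simp add: \<rho>_def[abs_def])
  have L_pos: "\<forall>\<^sub>F N in sequentially. L (\<kappa> N) > 0"
    using eventually_compose_filterlim[OF eventually_gt_at_top[of 0] \<kappa>_top]
    by eventually_elim (use \<open>M > 0\<close> in \<open>simp add: L_def\<close>)
  have \<rho>_pos: "\<forall>\<^sub>F N in sequentially. \<rho> N > 0"
    by (rule order_tendstoD[OF \<rho>_lim]) simp
  have "(\<lambda>N. real (pair_count x N (s / real N)) / real N) \<longlonglongrightarrow> 2 * s" if "s \<ge> 0" for s
  proof (rule order_tendstoI)
    fix a assume a: "a < 2 * s"
    show "\<forall>\<^sub>F N in sequentially. a < real (pair_count x N (s / real N)) / real N"
    proof (cases "a < 0")
      case True
      then show ?thesis by (intro always_eventually) (auto intro: less_le_trans)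
    next
      case False
      \<comment> \<open>Since \<open>a \<ge> 0\<close>, such a \<open>t\<close> is positive, as the
        assumed limit requires.\<close>
      obtain t where t: "t \<in> \<rat>" "a / 2 < t" "t < s"
        using Rats_dense_in_real[of "a / 2" s] a by auto
      have "(\<lambda>N. c t (\<kappa> N) / \<rho> N) \<longlonglongrightarrow> 2 * t / 1"
        using t False by (intro tendsto_divide filterlim_compose[OF c_lim \<kappa>_top] \<rho>_lim) auto
      then have "\<forall>\<^sub>F N in sequentially. a < c t (\<kappa> N) / \<rho> N"
        by (rule order_tendstoD) (use t in simp)
      moreover have "\<forall>\<^sub>F N in sequentially. t * \<rho> N < s"
        by (rule order_tendstoD[OF tendsto_mult_left[OF \<rho>_lim]]) (use t in simp)
      ultimately show ?thesis using L_pos \<rho>_pos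
      proof eventually_elim
        case (elim N)
        let ?L = "real (L (\<kappa> N))" and ?L' = "real (L (Suc (\<kappa> N)))"
        have N: "?L \<le> real N" "real N \<le> ?L'" "?L > 0"
          using L_le[of N] le_L[of N] elim by auto
        have L': "?L' = \<rho> N * ?L" using N by (simp add: \<rho>_def)
        \<comment> \<open>The condition \<open>t * \<rho> N < s\<close> makes the radius at the
          smaller index at most \<open>s / N\<close> for every \<open>N\<close> up to the next
          index.\<close>
        have "t / ?L \<le> s / ?L'"
          using elim N by (simp add: L' field_simps)
        also have "\<dots> \<le> s / real N"
          using N \<open>s \<ge> 0\<close> by (intro divide_left_mono) auto
        finally have "real (pair_count x (L (\<kappa> N)) (t / ?L)) \<le> real (pair_count x N (s / real N))"
          using pair_count_mono L_le of_nat_le_iff by blast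
        then have "real (pair_count x (L (\<kappa> N)) (t / ?L)) / ?L' \<le> real (pair_count x N (s / real N)) / real N"
          using N by (intro frac_le) auto
        also have "real (pair_count x (L (\<kappa> N)) (t / ?L)) / ?L' = c t (\<kappa> N) / \<rho> N"
          by (simp add: c_def L')
        finally show ?case using elim by simp
      qed
    qed
  next
    fix a assume a: "a > 2 * s"
    obtain t where t: "t \<in> \<rat>" "s < t" "t < a / 2"
      using Rats_dense_in_real[of s "a / 2"] a by auto
    have "(\<lambda>N. c t (Suc (\<kappa> N)) * \<rho> N) \<longlonglongrightarrow> 2 * t * 1"
      using t \<open>s \<ge> 0\<close> by (intro tendsto_mult filterlim_compose[OF c_lim Suc_\<kappa>_top] \<rho>_lim) auto
    then have "\<forall>\<^sub>F N in sequentially. c t (Suc (\<kappa> N)) * \<rho> N < a"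
      by (rule order_tendstoD) (use t in simp)
    moreover have "\<forall>\<^sub>F N in sequentially. s * \<rho> N < t"
      by (rule order_tendstoD[OF tendsto_mult_left[OF \<rho>_lim]]) (use t in simp)
    ultimately show "\<forall>\<^sub>F N in sequentially. real (pair_count x N (s / real N)) / real N < a"
      using L_pos \<rho>_pos
    proof eventually_elim
      case (elim N)
      let ?L = "real (L (\<kappa> N))" and ?L' = "real (L (Suc (\<kappa> N)))"
      have N: "?L \<le> real N" "real N \<le> ?L'" "?L > 0"
        using L_le[of N] le_L[of N] elim by auto
      have L': "?L' = \<rho> N * ?L" using N by (simp add: \<rho>_def)
      \<comment> \<open>Now the count is taken at the larger index and the normalisation at the
        smaller one, which costs the factor \<open>\<rho> N\<close>.\<close>
      have "s / real N \<le> s / ?L"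
        using N \<open>s \<ge> 0\<close> by (intro divide_left_mono) auto
      also have "\<dots> \<le> t / ?L'"
        using elim N by (simp add: L' field_simps)
      finally have "real (pair_count x N (s / real N)) \<le> real (pair_count x (L (Suc (\<kappa> N))) (t / ?L'))"
        using pair_count_mono le_L of_nat_le_iff by blast
      then have "real (pair_count x N (s / real N)) / real N \<le> real (pair_count x (L (Suc (\<kappa> N))) (t / ?L')) / ?L"
        using N by (intro frac_le) auto
      also have "\<dots> = c t (Suc (\<kappa> N)) * \<rho> N"
        using elim by (simp add: c_def L')
      finally show ?case using elim by simp
    qed
  qed
  then show ?thesis by (simp add: poissonian_pair_correlations_def pair_count_def)
qed

section \<open>Almost sure convergence from summable means, and conditioning by Fubini\<close>

context prob_space
begin

text \<open>The series of the \<open>U k\<close> from \<open>k0\<close> on has finite expectation,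
  so it converges almost surely and its terms tend to 0.\<close>

lemma AE_tendsto_zero_if_summable_expectation:
  fixes U :: "nat \<Rightarrow> 'a \<Rightarrow> real"
  assumes int: "\<And>k. integrable M (U k)" and nonneg: "\<And>k \<omega>. U k \<omega> \<ge> 0"
    and le: "\<forall>\<^sub>F k in sequentially. expectation (U k) \<le> c k" and c: "summable c"
  shows "AE \<omega> in M. (\<lambda>k. U k \<omega>) \<longlonglongrightarrow> 0"
proof -
  from le obtain k0 where k0: "\<And>k. k \<ge> k0 \<Longrightarrow> expectation (U k) \<le> c k"
    by (auto simp: eventually_sequentially)
  have [measurable]: "U k \<in> borel_measurable M" for k
    using int by auto
  have exp_nonneg: "expectation (U k) \<ge> 0" for k
    using nonneg by simp
  have c_nonneg: "c (k + k0) \<ge> 0" for k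
    using exp_nonneg[of "k + k0"] k0[of "k + k0"] by simp
  have "(\<integral>\<^sup>+\<omega>. (\<Sum>k. ennreal (U (k + k0) \<omega>)) \<partial>M) = (\<Sum>k. \<integral>\<^sup>+\<omega>. ennreal (U (k + k0) \<omega>) \<partial>M)"
    by (rule nn_integral_suminf) measurable
  also have "\<dots> = (\<Sum>k. ennreal (expectation (U (k + k0))))"
    using int nonneg by (simp add: nn_integral_eq_integral)
  also have "\<dots> \<le> (\<Sum>k. ennreal (c (k + k0)))"
    by (intro suminf_le ennreal_leI k0) auto
  also have "\<dots> = ennreal (\<Sum>k. c (k + k0))"
    by (rule suminf_ennreal2) (use c_nonneg summable_ignore_initial_segment[OF c] in auto)
  also have "\<dots> < \<infinity>" by simp
  finally have "AE \<omega> in M. (\<Sum>k. ennreal (U (k + k0) \<omega>)) \<noteq> \<infinity>"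
    by (intro nn_integral_noteq_infinite) (auto simp: less_top)
  then show ?thesis
  proof eventually_elim
    case (elim \<omega>)
    then have "summable (\<lambda>k. U (k + k0) \<omega>)"
      using nonneg by (intro summable_suminf_not_top) auto
    then have "(\<lambda>k. U (k + k0) \<omega>) \<longlonglongrightarrow> 0"
      by (rule summable_LIMSEQ_zero)
    then show ?case by (rule LIMSEQ_offset)
  qed
qed

text \<open>The joint law of \<open>U\<close> and \<open>V\<close> is a product, so Fubini permits
  integrating over \<open>V\<close> first, with the value of \<open>U\<close> frozen. This takes the
  place of conditional expectation given \<open>U\<close>.\<close>

lemma expectation_indep_const_section:
  fixes f :: "'b \<times> 'b \<Rightarrow> real"
  assumes ind: "indep_var S U T V" and f [measurable]: "f \<in> borel_measurable (S \<Otimes>\<^sub>M T)"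
    and bdd: "\<And>z. z \<in> space (S \<Otimes>\<^sub>M T) \<Longrightarrow> \<bar>f z\<bar> \<le> B"
    and sec: "\<And>x. x \<in> space S \<Longrightarrow> expectation (\<lambda>\<omega>. f (x, V \<omega>)) = c"
  shows "expectation (\<lambda>\<omega>. f (U \<omega>, V \<omega>)) = c"
proof -
  have [measurable]: "random_variable S U" "random_variable T V"
    and eq: "distr M S U \<Otimes>\<^sub>M distr M T V = distr M (S \<Otimes>\<^sub>M T) (\<lambda>\<omega>. (U \<omega>, V \<omega>))"
    using ind unfolding indep_var_distribution_eq by auto
  interpret DU: prob_space "distr M S U" by (rule prob_space_distr) simp
  interpret DV: prob_space "distr M T V" by (rule prob_space_distr) simp
  interpret pair_prob_space "distr M S U" "distr M T V" ..
  have int: "integrable (distr M S U \<Otimes>\<^sub>M distr M T V) f"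
    by (rule P.integrable_const_bound[where B=B])
       (use bdd in \<open>auto simp: space_pair_measure intro!: AE_I2\<close>)
  have "integral\<^sup>L M (\<lambda>\<omega>. f (U \<omega>, V \<omega>)) = integral\<^sup>L (distr M S U \<Otimes>\<^sub>M distr M T V) f"
    unfolding eq by (subst integral_distr) auto
  also have "\<dots> = (\<integral>x. (\<integral>y. f (x, y) \<partial>distr M T V) \<partial>distr M S U)"
    using int by (rule integral_fst'[symmetric])
  also have "\<dots> = (\<integral>x. c \<partial>distr M S U)"
  proof (rule Bochner_Integration.integral_cong)
    fix x assume "x \<in> space (distr M S U)"
    then have x: "x \<in> space S" by simp
    then have [measurable]: "(\<lambda>y. f (x, y)) \<in> borel_measurable T" by measurable
    show "(\<integral>y. f (x, y) \<partial>distr M T V) = c"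
      using sec[OF x] by (subst integral_distr) auto
  qed simp
  finally show ?thesis using DU.prob_space by simp
qed

end

section \<open>Jittered samples\<close>

context prob_space
begin

lemma expectation_of_bool: "expectation (\<lambda>\<omega>. of_bool (Q \<omega>)) = prob {\<omega> \<in> space M. Q \<omega>}"
proof -
  have "expectation (\<lambda>\<omega>. of_bool (Q \<omega>)) = expectation (indicator {\<omega> \<in> space M. Q \<omega>})"
    by (intro Bochner_Integration.integral_cong) auto
  also have "\<dots> = prob {\<omega> \<in> space M. Q \<omega>}"
    by (auto intro!: arg_cong[where f=prob])
  finally show ?thesis .
qed

lemma
  assumes "\<And>i j. i \<in> A \<Longrightarrow> j \<in> B \<Longrightarrow> Measurable.pred M (Q i j)"
  shows integrable_sum_sum_of_bool: "integrable M (\<lambda>\<omega>. \<Sum>i\<in>A. \<Sum>j\<in>B. of_bool (Q i j \<omega>) :: real)"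
    and expectation_sum_sum_of_bool: "expectation (\<lambda>\<omega>. \<Sum>i\<in>A. \<Sum>j\<in>B. of_bool (Q i j \<omega>)) =
      (\<Sum>i\<in>A. \<Sum>j\<in>B. prob {\<omega> \<in> space M. Q i j \<omega>})"
proof -
  have int: "integrable M (\<lambda>\<omega>. of_bool (Q i j \<omega>) :: real)" if "i \<in> A" "j \<in> B" for i j
    using assms[OF that] by (intro integrable_const_bound[where B=1]) auto
  show "integrable M (\<lambda>\<omega>. \<Sum>i\<in>A. \<Sum>j\<in>B. of_bool (Q i j \<omega>) :: real)"
    by (intro Bochner_Integration.integrable_sum int)
  have "expectation (\<lambda>\<omega>. \<Sum>i\<in>A. \<Sum>j\<in>B. (of_bool (Q i j \<omega>) :: real)) =
      (\<Sum>i\<in>A. expectation (\<lambda>\<omega>. \<Sum>j\<in>B. (of_bool (Q i j \<omega>) :: real)))"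
    by (intro Bochner_Integration.integral_sum Bochner_Integration.integrable_sum int)
  also have "\<dots> = (\<Sum>i\<in>A. \<Sum>j\<in>B. expectation (\<lambda>\<omega>. (of_bool (Q i j \<omega>) :: real)))"
    by (intro sum.cong refl Bochner_Integration.integral_sum int)
  finally show "expectation (\<lambda>\<omega>. \<Sum>i\<in>A. \<Sum>j\<in>B. (of_bool (Q i j \<omega>) :: real)) =
      (\<Sum>i\<in>A. \<Sum>j\<in>B. prob {\<omega> \<in> space M. Q i j \<omega>})"
    by (simp only: expectation_of_bool)
qed

text \<open>Two consequences of the joint independence are extracted for later use: the value of
  \<pi> at \<open>n\<close> is independent of \<open>Y n\<close>, and the family \<open>Y\<close> is
  independent.\<close>

lemma jittered_sampleE:
  assumes "jittered_sample M m X"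
  obtains \<pi> Y where "\<forall>\<omega>\<in>space M. \<pi> \<omega> permutes {1..m}"
    and "\<pi> \<in> measurable M (count_space {p. p permutes {1..m}})"
    and "\<forall>n\<in>{1..m}. Y n \<in> borel_measurable M"
    and "\<forall>n\<in>{1..m}. distr M borel (Y n) = unif"
    and "\<forall>n\<in>{1..m}. \<forall>k. \<forall>A\<in>sets borel.
      prob {\<omega> \<in> space M. \<pi> \<omega> n = k \<and> Y n \<omega> \<in> A} = prob {\<omega> \<in> space M. \<pi> \<omega> n = k} * measure unif A"
    and "indep_vars (\<lambda>_. borel) Y {1..m}"
    and "\<forall>n\<in>{1..m}. AE \<omega> in M. X n \<omega> = (real (\<pi> \<omega> n) - 1 + Y n \<omega>) / real m"
proof -
  let ?C = "count_space {p. p permutes {1..m}}"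
  let ?F = "\<lambda>\<pi> Y k. case k of
               None \<Rightarrow> {\<pi> -` A \<inter> space M | A. A \<in> sets ?C}
             | Some n \<Rightarrow> {Y n -` A \<inter> space M | A. A \<in> sets (borel :: real measure)}"
  obtain \<pi> Y where \<pi>: "\<pi> \<in> measurable M ?C"
    and Y: "\<And>n. n \<in> {1..m} \<Longrightarrow> Y n \<in> borel_measurable M"
    and unif: "\<And>n. n \<in> {1..m} \<Longrightarrow> distr M borel (Y n) = unif"
    and ind: "indep_sets (?F \<pi> Y) (insert None (Some ` {1..m}))"
    and X: "\<And>n. n \<in> {1..m} \<Longrightarrow> AE \<omega> in M. X n \<omega> = (real (\<pi> \<omega> n) - 1 + Y n \<omega>) / real m"
    using assms unfolding jittered_sample_def unif_def by blast
  have perm: "\<pi> \<omega> permutes {1..m}" if "\<omega> \<in> space M" for \<omega>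
    using measurable_space[OF \<pi> that] by simp
  have "prob {\<omega> \<in> space M. \<pi> \<omega> n = k \<and> Y n \<omega> \<in> A} = prob {\<omega> \<in> space M. \<pi> \<omega> n = k} * measure unif A"
    if n: "n \<in> {1..m}" and A: "A \<in> sets borel" for n k A
  proof -
    define E where "E i = (case i of None \<Rightarrow> {\<omega> \<in> space M. \<pi> \<omega> n = k} | Some n \<Rightarrow> Y n -` A \<inter> space M)" for i
    \<comment> \<open>The preimage of this set of permutations under \<pi> is the event that \<pi>
      maps \<open>n\<close> to \<open>k\<close>, which therefore lies in the sigma-algebra generated
      by \<pi>.\<close>
    let ?S = "{p. p permutes {1..m} \<and> p n = k}"
    have "E None = \<pi> -` ?S \<inter> space M"
      using perm by (auto simp: E_def)
    moreover have "?S \<in> sets ?C" by auto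
    ultimately have "E None \<in> ?F \<pi> Y None"
      unfolding option.case by blast
    moreover have "E (Some n) \<in> ?F \<pi> Y (Some n)" using A by (auto simp: E_def)
    ultimately have "prob (\<Inter>i\<in>{None, Some n}. E i) = (\<Prod>i\<in>{None, Some n}. prob (E i))"
      using n by (intro indep_setsD[OF ind]) auto
    also have "(\<Inter>i\<in>{None, Some n}. E i) = {\<omega> \<in> space M. \<pi> \<omega> n = k \<and> Y n \<omega> \<in> A}"
      by (auto simp: E_def)
    also have "(\<Prod>i\<in>{None, Some n}. prob (E i)) = prob {\<omega> \<in> space M. \<pi> \<omega> n = k} * measure unif A"
      using Y[OF n] A by (simp add: E_def measure_distr flip: unif[OF n])
    finally show ?thesis .
  qed
  moreover have "indep_vars (\<lambda>_. borel) Y {1..m}"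
    unfolding indep_vars_def2
  proof
    show "indep_sets (\<lambda>i. {Y i -` A \<inter> space M |A. A \<in> sets borel}) {1..m}"
    proof (rule indep_setsI)
      show "{Y i -` A \<inter> space M |A. A \<in> sets borel} \<subseteq> events" if "i \<in> {1..m}" for i
        using Y[OF that] by (auto intro: measurable_sets)
      fix A J assume "J \<noteq> {}" "J \<subseteq> {1..m}" "finite J"
        "\<forall>j\<in>J. A j \<in> {Y j -` A \<inter> space M |A. A \<in> sets borel}"
      \<comment> \<open>\<open>Some\<close> embeds \<open>J\<close> into the index set of the joint
        family; \<open>the\<close> undoes it.\<close>
      then have "prob (\<Inter>j\<in>Some ` J. A (the j)) = (\<Prod>j\<in>Some ` J. prob (A (the j)))"
        by (intro indep_setsD[OF ind]) auto
      then show "prob (\<Inter>j\<in>J. A j) = (\<Prod>j\<in>J. prob (A j))"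
        by (simp add: prod.reindex)
    qed
  qed (use Y in auto)
  ultimately show thesis
    using perm \<pi> Y unif X by (intro that[of \<pi> Y] ballI allI)
qed

text \<open>Exactly one sample point lies in each stratum, so the sum of the one-point distributions is
  uniform, whatever the law of the permutation.\<close>

lemma sum_prob_jittered_sample_circle_ball:
  assumes X: "jittered_sample M m X" and "m > 0" and \<delta>: "0 \<le> \<delta>" "\<delta> < 1/2"
  shows "(\<Sum>n=1..m. prob {\<omega> \<in> space M. dist_nearest_int (x - X n \<omega>) \<le> \<delta>}) = 2 * \<delta> * real m"
proof -
  obtain \<pi> Y where perm: "\<forall>\<omega>\<in>space M. \<pi> \<omega> permutes {1..m}"
    and \<pi>: "\<pi> \<in> measurable M (count_space {p. p permutes {1..m}})"
    and Y: "\<forall>n\<in>{1..m}. Y n \<in> borel_measurable M"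
    and unif: "\<forall>n\<in>{1..m}. distr M borel (Y n) = unif"
    and ind: "\<forall>n\<in>{1..m}. \<forall>k. \<forall>A\<in>sets borel.
      prob {\<omega> \<in> space M. \<pi> \<omega> n = k \<and> Y n \<omega> \<in> A} = prob {\<omega> \<in> space M. \<pi> \<omega> n = k} * measure unif A"
    and indY: "indep_vars (\<lambda>_. borel) Y {1..m}"
    and eq: "\<forall>n\<in>{1..m}. AE \<omega> in M. X n \<omega> = (real (\<pi> \<omega> n) - 1 + Y n \<omega>) / real m"
    using X by (rule jittered_sampleE)
  note perm = perm[rule_format] and Y = Y[rule_format] and unif = unif[rule_format]
    and ind = ind[rule_format] and eq = eq[rule_format]
  define A where "A k = {y. dist_nearest_int (x - (real k - 1 + y) / real m) \<le> \<delta>}" for k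
  have A [measurable]: "A k \<in> sets borel" for k
    unfolding A_def by measurable
  have meas_\<pi> [measurable]: "{\<omega> \<in> space M. \<pi> \<omega> n = k} \<in> events" for n k
  proof -
    have "{\<omega> \<in> space M. \<pi> \<omega> n = k} = \<pi> -` {p. p permutes {1..m} \<and> p n = k} \<inter> space M"
      using perm by auto
    also have "\<dots> \<in> events"
      by (rule measurable_sets[OF \<pi>]) auto
    finally show ?thesis .
  qed
  have meas: "{\<omega> \<in> space M. \<pi> \<omega> n = k \<and> Y n \<omega> \<in> A k} \<in> events" if "n \<in> {1..m}" for n k
    using Y[OF that] by measurable
  \<comment> \<open>The event is split by the value \<open>k\<close> of \<pi> at \<open>n\<close>;
    on each part it is, up to a null set, a condition on \<open>Y n\<close> alone.\<close>
  have one: "prob {\<omega> \<in> space M. dist_nearest_int (x - X n \<omega>) \<le> \<delta>} =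
      (\<Sum>k=1..m. prob {\<omega> \<in> space M. \<pi> \<omega> n = k} * measure unif (A k))" if n: "n \<in> {1..m}" for n
  proof -
    have Xn: "X n \<in> borel_measurable M"
      using X n by (auto simp: jittered_sample_def)
    have in_range: "\<pi> \<omega> n \<in> {1..m}" if "\<omega> \<in> space M" for \<omega>
      using perm[OF that] n by (simp only: permutes_in_image)
    have "prob {\<omega> \<in> space M. dist_nearest_int (x - X n \<omega>) \<le> \<delta>} =
        prob (\<Union>k\<in>{1..m}. {\<omega> \<in> space M. \<pi> \<omega> n = k \<and> Y n \<omega> \<in> A k})"
    proof (rule finite_measure_eq_AE)
      show "AE \<omega> in M. (\<omega> \<in> {\<omega> \<in> space M. dist_nearest_int (x - X n \<omega>) \<le> \<delta>}) =
          (\<omega> \<in> (\<Union>k\<in>{1..m}. {\<omega> \<in> space M. \<pi> \<omega> n = k \<and> Y n \<omega> \<in> A k}))"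
        using eq[OF n] by eventually_elim (use in_range in \<open>auto simp: A_def\<close>)
    qed (use Xn meas n in auto)
    also have "\<dots> = (\<Sum>k=1..m. prob {\<omega> \<in> space M. \<pi> \<omega> n = k \<and> Y n \<omega> \<in> A k})"
      using meas n by (intro finite_measure_finite_Union) (auto simp: disjoint_family_on_def)
    finally show ?thesis using n by (simp add: ind)
  qed
  \<comment> \<open>For fixed \<open>k\<close> these events partition the space: injectivity of the
    permutation makes them disjoint, surjectivity makes them exhaustive.\<close>
  have stratum: "(\<Sum>n=1..m. prob {\<omega> \<in> space M. \<pi> \<omega> n = k}) = 1" if k: "k \<in> {1..m}" for k
  proof -
    have "(\<Sum>n=1..m. prob {\<omega> \<in> space M. \<pi> \<omega> n = k}) = prob (\<Union>n\<in>{1..m}. {\<omega> \<in> space M. \<pi> \<omega> n = k})"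
    proof (rule finite_measure_finite_Union[symmetric])
      have "n = n'" if "\<omega> \<in> space M" "\<pi> \<omega> n = k" "\<pi> \<omega> n' = k" for \<omega> n n'
        using permutes_inj[OF perm[OF that(1)]] that(2,3) by (auto dest: injD)
      then show "disjoint_family_on (\<lambda>n. {\<omega> \<in> space M. \<pi> \<omega> n = k}) {1..m}"
        by (auto simp: disjoint_family_on_def)
    qed (use meas_\<pi> in auto)
    also have "(\<Union>n\<in>{1..m}. {\<omega> \<in> space M. \<pi> \<omega> n = k}) = space M"
    proof -
      have "\<exists>n\<in>{1..m}. \<pi> \<omega> n = k" if "\<omega> \<in> space M" for \<omega>
      proof -
        have "k \<in> \<pi> \<omega> ` {1..m}"
          unfolding permutes_image[OF perm[OF that]] by (rule k)
        then show ?thesis by auto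
      qed
      then show ?thesis by auto
    qed
    finally show ?thesis by (simp add: prob_space)
  qed
  have "(\<Sum>n=1..m. prob {\<omega> \<in> space M. dist_nearest_int (x - X n \<omega>) \<le> \<delta>}) =
      (\<Sum>n=1..m. \<Sum>k=1..m. prob {\<omega> \<in> space M. \<pi> \<omega> n = k} * measure unif (A k))"
    by (intro sum.cong refl one)
  also have "\<dots> = (\<Sum>k=1..m. (\<Sum>n=1..m. prob {\<omega> \<in> space M. \<pi> \<omega> n = k}) * measure unif (A k))"
    by (subst sum.swap) (simp add: sum_distrib_right)
  also have "\<dots> = (\<Sum>k=1..m. measure unif (A k))"
    by (intro sum.cong refl) (simp only: stratum mult_1)
  also have "\<dots> = 2 * \<delta> * real m"
    unfolding A_def using sum_measure_strata_circle_ball[OF \<delta> \<open>m > 0\<close>] .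
  finally show ?thesis .
qed

text \<open>Multiplication by \<open>m\<close> removes the permutation: \<open>m * (X i - X j)\<close> and \<open>Y i - Y j\<close> differ by
  an integer.\<close>

lemma prob_jittered_sample_pair_le:
  assumes X: "jittered_sample M m X" and "m > 0" and \<delta>: "0 \<le> \<delta>" "real m * \<delta> < 1/2"
    and ij: "i \<in> {1..m}" "j \<in> {1..m}" "i \<noteq> j"
  shows "prob {\<omega> \<in> space M. dist_nearest_int (X i \<omega> - X j \<omega>) \<le> \<delta>} \<le> 2 * real m * \<delta>"
proof -
  obtain \<pi> Y where perm: "\<forall>\<omega>\<in>space M. \<pi> \<omega> permutes {1..m}"
    and \<pi>: "\<pi> \<in> measurable M (count_space {p. p permutes {1..m}})"
    and Y: "\<forall>n\<in>{1..m}. Y n \<in> borel_measurable M"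
    and unif: "\<forall>n\<in>{1..m}. distr M borel (Y n) = unif"
    and ind: "\<forall>n\<in>{1..m}. \<forall>k. \<forall>A\<in>sets borel.
      prob {\<omega> \<in> space M. \<pi> \<omega> n = k \<and> Y n \<omega> \<in> A} = prob {\<omega> \<in> space M. \<pi> \<omega> n = k} * measure unif A"
    and indY: "indep_vars (\<lambda>_. borel) Y {1..m}"
    and eq: "\<forall>n\<in>{1..m}. AE \<omega> in M. X n \<omega> = (real (\<pi> \<omega> n) - 1 + Y n \<omega>) / real m"
    using X by (rule jittered_sampleE)
  note perm = perm[rule_format] and Y = Y[rule_format] and unif = unif[rule_format]
    and ind = ind[rule_format] and eq = eq[rule_format]
  have [measurable]: "Y i \<in> borel_measurable M" "Y j \<in> borel_measurable M"
    using Y ij by auto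
  have ind_var: "indep_var borel (Y i) borel (Y j)"
  proof -
    \<comment> \<open>Independence of two members of the family comes from the restrictions to the
      disjoint index sets \<open>{i}\<close> and \<open>{j}\<close>.\<close>
    have "indep_var borel ((\<lambda>f. f i) \<circ> (\<lambda>\<omega>. restrict (\<lambda>k. Y k \<omega>) {i}))
                    borel ((\<lambda>f. f j) \<circ> (\<lambda>\<omega>. restrict (\<lambda>k. Y k \<omega>) {j}))"
      using ij by (intro indep_var_compose[OF indep_var_restrict[OF indY]]) auto
    then show ?thesis by (simp add: comp_def)
  qed
  have "prob {\<omega> \<in> space M. dist_nearest_int (X i \<omega> - X j \<omega>) \<le> \<delta>} \<le>
      prob {\<omega> \<in> space M. dist_nearest_int (Y i \<omega> - Y j \<omega>) \<le> real m * \<delta>}"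
  proof (rule finite_measure_mono_AE)
    show "AE \<omega> in M. \<omega> \<in> {\<omega> \<in> space M. dist_nearest_int (X i \<omega> - X j \<omega>) \<le> \<delta>} \<longrightarrow>
        \<omega> \<in> {\<omega> \<in> space M. dist_nearest_int (Y i \<omega> - Y j \<omega>) \<le> real m * \<delta>}"
      using eq[OF ij(1)] eq[OF ij(2)]
    proof eventually_elim
      case (elim \<omega>)
      have "real m * (X i \<omega> - X j \<omega>) = (Y i \<omega> - Y j \<omega>) + of_int (int (\<pi> \<omega> i) - int (\<pi> \<omega> j))"
        using elim \<open>m > 0\<close> by (simp add: field_simps)
      then have "dist_nearest_int (Y i \<omega> - Y j \<omega>) = dist_nearest_int (real m * (X i \<omega> - X j \<omega>))"
        by (simp only: dist_nearest_int_add_int)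
      also have "\<dots> \<le> real m * dist_nearest_int (X i \<omega> - X j \<omega>)"
        by (rule dist_nearest_int_mult_nat_le)
      finally show ?case
        using \<open>m > 0\<close> by (auto intro: order_trans mult_left_mono)
    qed
  qed measurable
  \<comment> \<open>\<open>fst\<close> and \<open>snd\<close> exhibit the integrand as a function of
    the pair. With the first component fixed, its mean is the length of a ball on the
    circle.\<close>
  also have "\<dots> = expectation (\<lambda>\<omega>. of_bool (dist_nearest_int (fst (Y i \<omega>, Y j \<omega>) - snd (Y i \<omega>, Y j \<omega>)) \<le> real m * \<delta>))"
    by (simp add: expectation_of_bool)
  also have "\<dots> = 2 * (real m * \<delta>)"
  proof (rule expectation_indep_const_section[OF ind_var, where B=1])
    fix x :: real
    have "expectation (\<lambda>\<omega>. of_bool (dist_nearest_int (x - Y j \<omega>) \<le> real m * \<delta>)) =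
        measure (distr M borel (Y j)) {y. dist_nearest_int (x - y) \<le> real m * \<delta>}"
      unfolding expectation_of_bool
      by (subst measure_distr) (auto simp: vimage_def Int_def conj_commute)
    also have "\<dots> = 2 * (real m * \<delta>)"
      unfolding unif[OF ij(2)] using \<delta> by (intro measure_unif_circle_ball) auto
    finally show "expectation (\<lambda>\<omega>. of_bool (dist_nearest_int (fst (x, Y j \<omega>) - snd (x, Y j \<omega>)) \<le> real m * \<delta>)) = 2 * (real m * \<delta>)"
      by simp
  qed auto
  finally show ?thesis by simp
qed

end

section \<open>Close pairs within and between batches\<close>

definition near_pairs :: "nat \<Rightarrow> real \<Rightarrow> (nat \<Rightarrow> real) \<Rightarrow> (nat \<Rightarrow> real) \<Rightarrow> real" where
  "near_pairs m \<delta> y z = (\<Sum>n=1..m. \<Sum>n'=1..m. of_bool (dist_nearest_int (y n - z n') \<le> \<delta>))"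

definition near_pairs_within :: "nat \<Rightarrow> real \<Rightarrow> (nat \<Rightarrow> real) \<Rightarrow> real" where
  "near_pairs_within m \<delta> y =
    (\<Sum>n=1..m. \<Sum>n'=1..m. of_bool (n \<noteq> n' \<and> dist_nearest_int (y n - y n') \<le> \<delta>))"

text \<open>For \<open>0 \<le> \<delta> < 1/2\<close>, the subtracted constant is the mean of
  \<open>near_pairs\<close> when one tuple is fixed and the other is a jittered sample.\<close>

definition near_pairs_dev :: "nat \<Rightarrow> real \<Rightarrow> (nat \<Rightarrow> real) \<Rightarrow> (nat \<Rightarrow> real) \<Rightarrow> real" where
  "near_pairs_dev m \<delta> y z = near_pairs m \<delta> y z - 2 * \<delta> * (real m)\<^sup>2"

lemma near_pairs_commute: "near_pairs m \<delta> y z = near_pairs m \<delta> z y"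
  unfolding near_pairs_def by (subst sum.swap) (simp only: dist_nearest_int_commute)

lemma near_pairs_dev_commute: "near_pairs_dev m \<delta> y z = near_pairs_dev m \<delta> z y"
  by (simp add: near_pairs_dev_def near_pairs_commute)

lemma near_pairs_bounds: "0 \<le> near_pairs m \<delta> y z" "near_pairs m \<delta> y z \<le> (real m)\<^sup>2"
proof -
  have "near_pairs m \<delta> y z \<le> (\<Sum>n=1..m. \<Sum>n'=1..m. 1)"
    unfolding near_pairs_def by (intro sum_mono) auto
  then show "near_pairs m \<delta> y z \<le> (real m)\<^sup>2" by (simp add: power2_eq_square)
qed (auto simp: near_pairs_def intro: sum_nonneg)

lemma near_pairs_dev_bound: "\<bar>near_pairs_dev m \<delta> y z\<bar> \<le> (1 + 2 * \<bar>\<delta>\<bar>) * (real m)\<^sup>2"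
proof -
  have "\<bar>near_pairs_dev m \<delta> y z\<bar> \<le> \<bar>near_pairs m \<delta> y z\<bar> + \<bar>2 * \<delta> * (real m)\<^sup>2\<bar>"
    unfolding near_pairs_dev_def by (rule abs_triangle_ineq4)
  also have "\<dots> \<le> (real m)\<^sup>2 + 2 * \<bar>\<delta>\<bar> * (real m)\<^sup>2"
    using near_pairs_bounds[of m \<delta> y z] by (simp add: abs_mult)
  finally show ?thesis by (simp add: distrib_right)
qed

text \<open>For the count \<open>f\<close> one has \<open>f\<^sup>2 \<le> m\<^sup>2 * f\<close>;
  substituting \<open>f\<close> as deviation plus mean and dropping the negative square of the mean
  gives the bound. It is affine in the deviation, so that its expectation is of order \<delta> once
  the deviation is centred.\<close>

lemma near_pairs_dev_sq_le:
  "(near_pairs_dev m \<delta> y z)\<^sup>2 \<le> 2 * \<delta> * (real m) ^ 4 + ((real m)\<^sup>2 - 4 * \<delta> * (real m)\<^sup>2) * near_pairs_dev m \<delta> y z"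
proof -
  define f where "f = near_pairs m \<delta> y z"
  have "f\<^sup>2 \<le> (real m)\<^sup>2 * f"
    unfolding power2_eq_square[of f] unfolding f_def by (intro mult_right_mono near_pairs_bounds)
  moreover have "0 \<le> (2 * \<delta> * (real m)\<^sup>2)\<^sup>2" by simp
  ultimately show ?thesis
    unfolding near_pairs_dev_def f_def[symmetric] by (simp add: power2_eq_square power4_eq_xxxx algebra_simps)
qed

lemma borel_measurable_near_pairs_dev [measurable (raw)]:
  assumes "Y \<in> measurable N (\<Pi>\<^sub>M n\<in>{1..m}. borel)" "Z \<in> measurable N (\<Pi>\<^sub>M n\<in>{1..m}. borel)"
  shows "(\<lambda>\<omega>. near_pairs_dev m \<delta> (Y \<omega>) (Z \<omega>)) \<in> borel_measurable N"
proof -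
  have [measurable]: "(\<lambda>\<omega>. Y \<omega> n) \<in> borel_measurable N" "(\<lambda>\<omega>. Z \<omega> n) \<in> borel_measurable N"
    if "n \<in> {1..m}" for n
    using assms that by (auto intro: measurable_compose[OF _ measurable_component_singleton])
  show ?thesis
    unfolding near_pairs_dev_def near_pairs_def
    by (intro borel_measurable_diff borel_measurable_sum) measurable
qed

lemma borel_measurable_near_pairs_within [measurable (raw)]:
  assumes "Y \<in> measurable N (\<Pi>\<^sub>M n\<in>{1..m}. borel)"
  shows "(\<lambda>\<omega>. near_pairs_within m \<delta> (Y \<omega>)) \<in> borel_measurable N"
proof -
  have [measurable]: "(\<lambda>\<omega>. Y \<omega> n) \<in> borel_measurable N" if "n \<in> {1..m}" for n
    using assms that by (auto intro: measurable_compose[OF _ measurable_component_singleton])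
  show ?thesis
    unfolding near_pairs_within_def
    by (intro borel_measurable_sum) measurable
qed

lemma near_pairs_within_bounds: "0 \<le> near_pairs_within m \<delta> y" "near_pairs_within m \<delta> y \<le> (real m)\<^sup>2"
proof -
  have "near_pairs_within m \<delta> y \<le> (\<Sum>n=1..m. \<Sum>n'=1..m. 1)"
    unfolding near_pairs_within_def by (intro sum_mono) auto
  then show "near_pairs_within m \<delta> y \<le> (real m)\<^sup>2" by (simp add: power2_eq_square)
qed (auto simp: near_pairs_within_def intro: sum_nonneg)

section \<open>Decomposition of the pair count into batches\<close>

lemma sum_batches:
  fixes f :: "nat \<Rightarrow> 'b :: comm_monoid_add"
  shows "(\<Sum>i=1..m * K. f i) = (\<Sum>a<K. \<Sum>n=1..m. f (a * m + n))"
proof (induction K)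
  case (Suc K)
  have "(\<Sum>i=1..m * Suc K. f i) = (\<Sum>i=1..m * K. f i) + (\<Sum>i=m * K + 1..m * K + m. f i)"
    by (subst sum.ub_add_nat[symmetric]) (auto simp: add.commute)
  also have "(\<Sum>i=m * K + 1..m * K + m. f i) = (\<Sum>n=1..m. f (K * m + n))"
    using sum.shift_bounds_cl_nat_ivl[of f 1 "m * K" m] by (simp add: ac_simps)
  finally show ?case using Suc by simp
qed simp

definition batch_pairs :: "nat \<Rightarrow> (nat \<times> nat) set" where
  "batch_pairs K = {(a, b). a < K \<and> b < K \<and> a \<noteq> b}"

lemma finite_batch_pairs [simp]: "finite (batch_pairs K)"
  by (rule finite_subset[where B="{..<K} \<times> {..<K}"]) (auto simp: batch_pairs_def)

lemma sum_split_diagonal: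
  fixes f :: "nat \<Rightarrow> nat \<Rightarrow> 'b :: comm_monoid_add"
  shows "(\<Sum>a<K. \<Sum>b<K. f a b) = (\<Sum>(a, b)\<in>batch_pairs K. f a b) + (\<Sum>a<K. f a a)"
proof -
  have "(\<Sum>a<K. \<Sum>b<K. f a b) = (\<Sum>(a, b)\<in>{..<K} \<times> {..<K}. f a b)"
    by (rule sum.cartesian_product)
  also have "{..<K} \<times> {..<K} = batch_pairs K \<union> (\<lambda>a. (a, a)) ` {..<K}"
    by (auto simp: batch_pairs_def)
  also have "(\<Sum>(a, b)\<in>\<dots>. f a b) = (\<Sum>(a, b)\<in>batch_pairs K. f a b) + (\<Sum>(a, b)\<in>(\<lambda>a. (a, a)) ` {..<K}. f a b)"
    by (rule sum.union_disjoint) (simp, simp, auto simp: batch_pairs_def)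
  also have "(\<Sum>(a, b)\<in>(\<lambda>a. (a, a)) ` {..<K}. f a b) = (\<Sum>a<K. f a a)"
    by (subst sum.reindex) (auto simp: inj_on_def)
  finally show ?thesis .
qed

lemma card_batch_pairs: "real (card (batch_pairs K)) = (real K)\<^sup>2 - real K"
  using sum_split_diagonal[of "\<lambda>_ _. 1 :: real" K] by (simp add: power2_eq_square)

lemma pair_count_eq_sum:
  "real (pair_count x N \<delta>) = (\<Sum>i=1..N. \<Sum>j=1..N. of_bool (i \<noteq> j \<and> dist_nearest_int (x i - x j) \<le> \<delta>))"
proof -
  let ?Q = "\<lambda>(i, j). i \<noteq> j \<and> dist_nearest_int (x i - x j) \<le> \<delta>"
  have "real (pair_count x N \<delta>) = real (card (({1..N} \<times> {1..N}) \<inter> {p. ?Q p}))"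
    unfolding pair_count_def by (intro arg_cong[where f="\<lambda>A. real (card A)"]) auto
  also have "\<dots> = (\<Sum>p\<in>{1..N} \<times> {1..N}. of_bool (?Q p))"
    by simp
  also have "\<dots> = (\<Sum>i=1..N. \<Sum>j=1..N. of_bool (?Q (i, j)))"
    by (subst sum.cartesian_product) (simp add: case_prod_beta)
  finally show ?thesis by simp
qed

lemma batch_index_eq_iff:
  fixes a b m n n' :: nat
  assumes "n \<in> {1..m}" "n' \<in> {1..m}"
  shows "a * m + n = b * m + n' \<longleftrightarrow> a = b \<and> n = n'"
proof
  assume eq: "a * m + n = b * m + n'"
  \<comment> \<open>Positions in a batch run from 1 to \<open>m\<close>, so the remainder modulo
    \<open>m\<close> is the position minus 1.\<close>
  have div: "(c * m + (k - 1)) div m = c" if "k \<in> {1..m}" for c k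
  proof -
    have "k - 1 < m" using that by auto
    then show ?thesis by simp
  qed
  have "a * m + (n - 1) = b * m + (n' - 1)" using eq assms by auto
  then have "a = b" using div assms by metis
  with eq show "a = b \<and> n = n'" by simp
qed simp

lemma pair_count_batches:
  "real (pair_count x (m * K) \<delta>) =
     (\<Sum>(a, b)\<in>batch_pairs K. near_pairs m \<delta> (\<lambda>n\<in>{1..m}. x (a * m + n)) (\<lambda>n\<in>{1..m}. x (b * m + n))) +
     (\<Sum>a<K. near_pairs_within m \<delta> (\<lambda>n\<in>{1..m}. x (a * m + n)))"
proof -
  define h where "h a b = (\<Sum>n=1..m. \<Sum>n'=1..m. (of_bool (a * m + n \<noteq> b * m + n' \<and>
      dist_nearest_int (x (a * m + n) - x (b * m + n')) \<le> \<delta>) :: real))" for a b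
  have "real (pair_count x (m * K) \<delta>) = (\<Sum>a<K. \<Sum>b<K. h a b)"
    \<comment> \<open>The sums come nested as \<open>a\<close>, \<open>n\<close>, \<open>b\<close>,
      \<open>n'\<close>; swapping the middle two brings the batch indices to the front.\<close>
    unfolding pair_count_eq_sum sum_batches h_def
    by (intro sum.cong refl sum.swap)
  also have "\<dots> = (\<Sum>(a, b)\<in>batch_pairs K. h a b) + (\<Sum>a<K. h a a)"
    by (rule sum_split_diagonal)
  also have "(\<Sum>(a, b)\<in>batch_pairs K. h a b) = (\<Sum>(a, b)\<in>batch_pairs K. near_pairs m \<delta> (\<lambda>n\<in>{1..m}. x (a * m + n)) (\<lambda>n\<in>{1..m}. x (b * m + n)))"
    by (intro sum.cong refl)
       (auto simp: h_def near_pairs_def batch_pairs_def batch_index_eq_iff intro!: sum.cong)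
  also have "(\<Sum>a<K. h a a) = (\<Sum>a<K. near_pairs_within m \<delta> (\<lambda>n\<in>{1..m}. x (a * m + n)))"
    by (intro sum.cong refl) (auto simp: h_def near_pairs_within_def intro!: sum.cong)
  finally show ?thesis .
qed

section \<open>The variance of the number of close pairs\<close>

text \<open>The batch size is \<open>m\<close> here because \<open>M\<close> is the probability
  measure of \<open>prob_space\<close>.\<close>

locale batch_jittered = prob_space +
  fixes m :: nat and X :: "nat \<Rightarrow> 'a \<Rightarrow> real"
  assumes m_pos: "m > 0" and batch_jittered: "batch_jittered_sequence M m X"
begin

definition batch :: "nat \<Rightarrow> 'a \<Rightarrow> nat \<Rightarrow> real" where
  "batch j \<omega> = (\<lambda>n\<in>{1..m}. X (j * m + n) \<omega>)"

lemma jittered_sample_batch: "jittered_sample M m (\<lambda>n. X (j * m + n))"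
  using batch_jittered by (simp add: batch_jittered_sequence_def)

lemma indep_vars_batch: "indep_vars (\<lambda>_. \<Pi>\<^sub>M n\<in>{1..m}. borel) batch UNIV"
  using batch_jittered by (simp add: batch_jittered_sequence_def batch_def[abs_def])

lemma measurable_batch [measurable]: "batch j \<in> measurable M (\<Pi>\<^sub>M n\<in>{1..m}. borel)"
  using indep_vars_batch by (simp add: indep_vars_def2)

lemma measurable_X: "n \<in> {1..m} \<Longrightarrow> X (j * m + n) \<in> borel_measurable M"
  using jittered_sample_batch[of j] by (simp add: jittered_sample_def)

lemma integrable_near_pairs_dev [simp]: "integrable M (\<lambda>\<omega>. near_pairs_dev m \<delta> (batch a \<omega>) (batch b \<omega>))"
  by (rule integrable_const_bound[where B="(1 + 2 * \<bar>\<delta>\<bar>) * (real m)\<^sup>2"]) (auto simp: near_pairs_dev_bound)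

lemma integrable_near_pairs_dev_mult [simp]:
  "integrable M (\<lambda>\<omega>. near_pairs_dev m \<delta> (batch a \<omega>) (batch b \<omega>) * near_pairs_dev m \<delta> (batch c \<omega>) (batch d \<omega>))"
proof (rule integrable_const_bound)
  show "AE \<omega> in M. norm (near_pairs_dev m \<delta> (batch a \<omega>) (batch b \<omega>) *
      near_pairs_dev m \<delta> (batch c \<omega>) (batch d \<omega>)) \<le>
      ((1 + 2 * \<bar>\<delta>\<bar>) * (real m)\<^sup>2) * ((1 + 2 * \<bar>\<delta>\<bar>) * (real m)\<^sup>2)"
    unfolding real_norm_def abs_mult
    by (intro AE_I2 mult_mono near_pairs_dev_bound) auto
qed measurable

definition total_dev :: "real \<Rightarrow> nat \<Rightarrow> 'a \<Rightarrow> real" where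
  "total_dev \<delta> K \<omega> = (\<Sum>(a, b)\<in>batch_pairs K. near_pairs_dev m \<delta> (batch a \<omega>) (batch b \<omega>))"

lemma total_dev_sq: "(total_dev \<delta> K \<omega>)\<^sup>2 = (\<Sum>(a, b)\<in>batch_pairs K. \<Sum>(c, d)\<in>batch_pairs K.
    near_pairs_dev m \<delta> (batch a \<omega>) (batch b \<omega>) * near_pairs_dev m \<delta> (batch c \<omega>) (batch d \<omega>))"
  by (simp add: total_dev_def power2_eq_square sum_product case_prod_beta)

lemma integrable_total_dev_sq: "integrable M (\<lambda>\<omega>. (total_dev \<delta> K \<omega>)\<^sup>2)"
  unfolding total_dev_sq case_prod_beta by (intro Bochner_Integration.integrable_sum) simp

context
  fixes \<delta> :: real
  assumes \<delta>: "0 \<le> \<delta>" "\<delta> < 1/2"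
begin

text \<open>Each of the \<open>m\<close> points of \<open>y\<close> has on average
  \<open>2 * \<delta> * m\<close> points of the batch near it, wherever it lies. That
  \<open>y\<close> is arbitrary is the source of all the orthogonality below.\<close>

lemma expectation_near_pairs_dev_section: "expectation (\<lambda>\<omega>. near_pairs_dev m \<delta> y (batch b \<omega>)) = 0"
proof -
  have pred: "Measurable.pred M (\<lambda>\<omega>. dist_nearest_int (y n - X (b * m + n') \<omega>) \<le> \<delta>)"
    if "n' \<in> {1..m}" for n n'
    using measurable_X[OF that] by measurable
  have near: "near_pairs m \<delta> y (batch b \<omega>) =
      (\<Sum>n=1..m. \<Sum>n'=1..m. of_bool (dist_nearest_int (y n - X (b * m + n') \<omega>) \<le> \<delta>))" for \<omega>
    unfolding near_pairs_def by (intro sum.cong refl) (simp add: batch_def)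
  have "expectation (\<lambda>\<omega>. near_pairs m \<delta> y (batch b \<omega>)) =
      (\<Sum>n=1..m. \<Sum>n'=1..m. prob {\<omega> \<in> space M. dist_nearest_int (y n - X (b * m + n') \<omega>) \<le> \<delta>})"
    unfolding near by (intro expectation_sum_sum_of_bool pred)
  also have "\<dots> = (\<Sum>n=1..m. 2 * \<delta> * real m)"
    by (intro sum.cong refl sum_prob_jittered_sample_circle_ball[OF jittered_sample_batch m_pos \<delta>])
  also have "\<dots> = 2 * \<delta> * (real m)\<^sup>2"
    by (simp add: power2_eq_square)
  finally have *: "expectation (\<lambda>\<omega>. near_pairs m \<delta> y (batch b \<omega>)) = 2 * \<delta> * (real m)\<^sup>2" .
  have "integrable M (\<lambda>\<omega>. near_pairs m \<delta> y (batch b \<omega>))"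
    unfolding near by (intro integrable_sum_sum_of_bool pred)
  then show ?thesis
    unfolding near_pairs_dev_def by (subst Bochner_Integration.integral_diff) (auto simp: * prob_space)
qed

text \<open>Fixing the batches with index in \<open>I\<close> fixes \<open>h\<close> and batch
  \<open>a\<close>. What remains random is the independent batch \<open>b\<close>, and its deviation
  from a fixed tuple has mean 0.\<close>

lemma expectation_near_pairs_dev_mult_indep:
  assumes "a \<in> I" "b \<notin> I" and h [measurable]: "h \<in> borel_measurable (\<Pi>\<^sub>M i\<in>I. \<Pi>\<^sub>M n\<in>{1..m}. borel)"
    and bdd: "\<And>z. \<bar>h z\<bar> \<le> C"
  shows "expectation (\<lambda>\<omega>. near_pairs_dev m \<delta> (batch a \<omega>) (batch b \<omega>) * h (\<lambda>i\<in>I. batch i \<omega>)) = 0"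
proof -
  let ?N = "\<lambda>_. \<Pi>\<^sub>M n\<in>{1..m}. borel :: real measure"
  let ?f = "\<lambda>p. near_pairs_dev m \<delta> (fst p a) (snd p b) * h (fst p)"
  have "indep_var (PiM I ?N) (\<lambda>\<omega>. \<lambda>i\<in>I. batch i \<omega>) (PiM {b} ?N) (\<lambda>\<omega>. \<lambda>i\<in>{b}. batch i \<omega>)"
    using assms by (intro indep_var_restrict[OF indep_vars_batch]) auto
  then have "expectation (\<lambda>\<omega>. ?f (\<lambda>i\<in>I. batch i \<omega>, \<lambda>i\<in>{b}. batch i \<omega>)) = 0"
  proof (rule expectation_indep_const_section[where B="(1 + 2 * \<bar>\<delta>\<bar>) * (real m)\<^sup>2 * C"])
    have "(\<lambda>p. fst p a) \<in> measurable (PiM I ?N \<Otimes>\<^sub>M PiM {b} ?N) (?N a)"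
      by (rule measurable_compose[OF measurable_fst measurable_component_singleton[OF \<open>a \<in> I\<close>]])
    moreover have "(\<lambda>p. snd p b) \<in> measurable (PiM I ?N \<Otimes>\<^sub>M PiM {b} ?N) (?N b)"
      by (rule measurable_compose[OF measurable_snd measurable_component_singleton]) simp
    ultimately show "?f \<in> borel_measurable (PiM I ?N \<Otimes>\<^sub>M PiM {b} ?N)"
      by (intro borel_measurable_times borel_measurable_near_pairs_dev
            measurable_compose[OF measurable_fst h])
  next
    fix p
    show "\<bar>?f p\<bar> \<le> (1 + 2 * \<bar>\<delta>\<bar>) * (real m)\<^sup>2 * C"
      unfolding abs_mult by (intro mult_mono near_pairs_dev_bound bdd) auto
  next
    fix z
    show "expectation (\<lambda>\<omega>. ?f (z, \<lambda>i\<in>{b}. batch i \<omega>)) = 0"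
      using expectation_near_pairs_dev_section[of "z a" b] by simp
  qed
  then show ?thesis using \<open>a \<in> I\<close> by simp
qed

lemma expectation_near_pairs_dev:
  assumes "a \<noteq> b"
  shows "expectation (\<lambda>\<omega>. near_pairs_dev m \<delta> (batch a \<omega>) (batch b \<omega>)) = 0"
  using expectation_near_pairs_dev_mult_indep[of a "{a}" b "\<lambda>_. 1" 1] assms by simp

text \<open>One of \<open>a\<close> and \<open>b\<close> lies outside \<open>{c, d}\<close>. Its
  batch enters the product only once, so averaging over it alone already gives 0.\<close>

lemma expectation_near_pairs_dev_mult:
  assumes "a \<noteq> b" "c \<noteq> d" "{a, b} \<noteq> {c, d}"
  shows "expectation (\<lambda>\<omega>. near_pairs_dev m \<delta> (batch a \<omega>) (batch b \<omega>) *
           near_pairs_dev m \<delta> (batch c \<omega>) (batch d \<omega>)) = 0"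
proof -
  have *: "expectation (\<lambda>\<omega>. near_pairs_dev m \<delta> (batch a \<omega>) (batch b \<omega>) *
           near_pairs_dev m \<delta> (batch c \<omega>) (batch d \<omega>)) = 0" if "b \<notin> {a, c, d}" for a b
  proof -
    let ?I = "{a, c, d}"
    have "(\<lambda>z. near_pairs_dev m \<delta> (z c) (z d)) \<in> borel_measurable (\<Pi>\<^sub>M i\<in>?I. \<Pi>\<^sub>M n\<in>{1..m}. borel)"
      by (intro borel_measurable_near_pairs_dev measurable_component_singleton) auto
    from expectation_near_pairs_dev_mult_indep[OF _ that this near_pairs_dev_bound, of a]
    show ?thesis by simp
  qed
  show ?thesis
  proof (cases "b \<in> {c, d}")
    \<comment> \<open>Here \<open>a\<close> is the index that occurs only once, and the symmetry of
      the deviation exchanges the roles of \<open>a\<close> and \<open>b\<close>.\<close>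
    case True
    then have "a \<notin> {b, c, d}" using assms by auto
    from *[OF this] show ?thesis by (simp only: near_pairs_dev_commute[of m \<delta> "batch b _"])
  qed (use * assms in auto)
qed

text \<open>In the affine bound of \<open>near_pairs_dev_sq_le\<close> the linear term has mean
  0.\<close>

lemma expectation_near_pairs_dev_sq_le:
  assumes "a \<noteq> b"
  shows "expectation (\<lambda>\<omega>. (near_pairs_dev m \<delta> (batch a \<omega>) (batch b \<omega>))\<^sup>2) \<le> 2 * \<delta> * (real m) ^ 4"
proof -
  let ?D = "\<lambda>\<omega>. near_pairs_dev m \<delta> (batch a \<omega>) (batch b \<omega>)"
  let ?c = "(real m)\<^sup>2 - 4 * \<delta> * (real m)\<^sup>2"
  have "expectation (\<lambda>\<omega>. (?D \<omega>)\<^sup>2) \<le> expectation (\<lambda>\<omega>. 2 * \<delta> * (real m) ^ 4 + ?c * ?D \<omega>)"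
    by (intro integral_mono near_pairs_dev_sq_le) (simp_all add: power2_eq_square)
  also have "\<dots> = 2 * \<delta> * (real m) ^ 4"
    by (subst Bochner_Integration.integral_add) (simp_all add: expectation_near_pairs_dev[OF assms] prob_space)
  finally show ?thesis .
qed

text \<open>After expanding the square, a pair \<open>p\<close> of batches correlates only with
  itself and with its swap, so each of the at most \<open>K\<^sup>2\<close> ordered pairs
  contributes at most two variances.\<close>

lemma expectation_total_dev_sq_le:
  "expectation (\<lambda>\<omega>. (total_dev \<delta> K \<omega>)\<^sup>2) \<le> 4 * \<delta> * (real m) ^ 4 * (real K)\<^sup>2"
proof -
  let ?D = "\<lambda>p \<omega>. near_pairs_dev m \<delta> (batch (fst p) \<omega>) (batch (snd p) \<omega>)"
  let ?v = "2 * \<delta> * (real m) ^ 4"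
  have "expectation (\<lambda>\<omega>. (total_dev \<delta> K \<omega>)\<^sup>2) =
      (\<Sum>p\<in>batch_pairs K. \<Sum>q\<in>batch_pairs K. expectation (\<lambda>\<omega>. ?D p \<omega> * ?D q \<omega>))"
    unfolding total_dev_sq case_prod_beta
    by (simp add: Bochner_Integration.integral_sum Bochner_Integration.integrable_sum)
  also have "\<dots> \<le> (\<Sum>p\<in>batch_pairs K. 2 * ?v)"
  proof (rule sum_mono)
    fix p assume p: "p \<in> batch_pairs K"
    have le: "expectation (\<lambda>\<omega>. ?D p \<omega> * ?D q \<omega>) \<le> (if q \<in> {p, prod.swap p} then ?v else 0)"
      if q: "q \<in> batch_pairs K" for q
    proof (cases "q \<in> {p, prod.swap p}")
      case True
      then have "?D q \<omega> = ?D p \<omega>" for \<omega>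
        using near_pairs_dev_commute by auto
      then show ?thesis
        using True p expectation_near_pairs_dev_sq_le[of "fst p" "snd p"]
        by (auto simp: batch_pairs_def power2_eq_square)
    next
      case False
      then have ne: "{fst p, snd p} \<noteq> {fst q, snd q}"
        by (auto simp: doubleton_eq_iff prod_eq_iff)
      have "fst p \<noteq> snd p" "fst q \<noteq> snd q"
        using p q by (auto simp: batch_pairs_def)
      from expectation_near_pairs_dev_mult[OF this ne] show ?thesis
        using False by simp
    qed
    have "(\<Sum>q\<in>batch_pairs K. expectation (\<lambda>\<omega>. ?D p \<omega> * ?D q \<omega>)) \<le>
        (\<Sum>q\<in>batch_pairs K. if q \<in> {p, prod.swap p} then ?v else 0)"
      by (rule sum_mono) (rule le)
    also have "\<dots> = (\<Sum>q\<in>batch_pairs K \<inter> {p, prod.swap p}. ?v)"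
      by (subst sum.inter_restrict) auto
    also have "\<dots> \<le> (\<Sum>q\<in>{p, prod.swap p}. ?v)"
      using \<delta> by (intro sum_mono2) auto
    also have "\<dots> \<le> 2 * ?v"
      using \<delta> by (cases "p = prod.swap p") auto
    finally show "(\<Sum>q\<in>batch_pairs K. expectation (\<lambda>\<omega>. ?D p \<omega> * ?D q \<omega>)) \<le> 2 * ?v" .
  qed
  also have "\<dots> = ((real K)\<^sup>2 - real K) * (2 * ?v)"
    by (simp add: card_batch_pairs)
  also have "\<dots> \<le> (real K)\<^sup>2 * (2 * ?v)"
    using \<delta> by (intro mult_right_mono) auto
  finally show ?thesis by (simp add: mult_ac)
qed

text \<open>Each of the at most \<open>m\<^sup>2\<close> pairs is close with probability at most
  \<open>2 * m * \<delta>\<close>. The stronger smallness condition stems from the scaling by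
  \<open>m\<close> in that estimate.\<close>

lemma expectation_near_pairs_within_le:
  assumes "real m * \<delta> < 1/2"
  shows "expectation (\<lambda>\<omega>. near_pairs_within m \<delta> (batch a \<omega>)) \<le> 2 * (real m) ^ 3 * \<delta>"
proof -
  let ?Q = "\<lambda>n n' \<omega>. n \<noteq> n' \<and> dist_nearest_int (X (a * m + n) \<omega> - X (a * m + n') \<omega>) \<le> \<delta>"
  have pred: "Measurable.pred M (?Q n n')" if "n \<in> {1..m}" "n' \<in> {1..m}" for n n'
    using that[THEN measurable_X] by measurable
  have near: "near_pairs_within m \<delta> (batch a \<omega>) = (\<Sum>n=1..m. \<Sum>n'=1..m. of_bool (?Q n n' \<omega>))" for \<omega>
    unfolding near_pairs_within_def by (intro sum.cong refl) (simp add: batch_def)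
  have "expectation (\<lambda>\<omega>. near_pairs_within m \<delta> (batch a \<omega>)) = (\<Sum>n=1..m. \<Sum>n'=1..m. prob {\<omega> \<in> space M. ?Q n n' \<omega>})"
    unfolding near by (intro expectation_sum_sum_of_bool pred)
  also have "\<dots> \<le> (\<Sum>n=1..m. \<Sum>n'=1..m. 2 * real m * \<delta>)"
  proof (intro sum_mono)
    fix n n' assume "n \<in> {1..m}" "n' \<in> {1..m}"
    then show "prob {\<omega> \<in> space M. ?Q n n' \<omega>} \<le> 2 * real m * \<delta>"
      using prob_jittered_sample_pair_le[OF jittered_sample_batch m_pos \<delta>(1) assms] \<delta>
      by (cases "n = n'") auto
  qed
  also have "\<dots> = 2 * (real m) ^ 3 * \<delta>"
    by (simp add: power3_eq_cube)
  finally show ?thesis .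
qed

end

end

section \<open>Almost sure convergence\<close>

context batch_jittered
begin

text \<open>The mean is added back once for each of the \<open>K\<^sup>2 - K\<close> ordered pairs
  of distinct batches.\<close>

lemma pair_count_eq_total_dev:
  "real (pair_count (\<lambda>n. X n \<omega>) (m * K) \<delta>) =
     total_dev \<delta> K \<omega> + ((real K)\<^sup>2 - real K) * (2 * \<delta> * (real m)\<^sup>2) +
     (\<Sum>a<K. near_pairs_within m \<delta> (batch a \<omega>))"
proof -
  have "(\<Sum>(a, b)\<in>batch_pairs K. near_pairs m \<delta> (batch a \<omega>) (batch b \<omega>)) =
      total_dev \<delta> K \<omega> + ((real K)\<^sup>2 - real K) * (2 * \<delta> * (real m)\<^sup>2)"
    by (simp add: total_dev_def near_pairs_dev_def case_prod_beta sum_subtractf card_batch_pairs)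
  then show ?thesis
    by (simp add: pair_count_batches batch_def)
qed

text \<open>With \<open>k\<^sup>2\<close> complete batches, the normalised count is a centred
  fluctuation, an explicit mean tending to \<open>2 * t\<close>, and the contribution from inside
  batches. The square of the first and the third have expectations of order
  \<open>1 / k\<^sup>2\<close>.\<close>

lemma AE_pair_count_tendsto:
  assumes "t \<ge> 0"
  shows "AE \<omega> in M. (\<lambda>k. real (pair_count (\<lambda>n. X n \<omega>) (m * k\<^sup>2) (t / real (m * k\<^sup>2))) / real (m * k\<^sup>2))
           \<longlonglongrightarrow> 2 * t"
proof -
  define N where "N k = real (m * k\<^sup>2)" for k
  define \<delta> where "\<delta> k = t / N k" for k
  define V where "V k \<omega> = (total_dev (\<delta> k) (k\<^sup>2) \<omega> / N k)\<^sup>2" for k \<omega>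
  define W where "W k \<omega> = (\<Sum>a<k\<^sup>2. near_pairs_within m (\<delta> k) (batch a \<omega>)) / N k" for k \<omega>
  have \<delta>_nonneg: "\<delta> k \<ge> 0" for k
    using assms by (simp add: \<delta>_def N_def)
  have "(\<lambda>k. real m * \<delta> k) \<longlonglongrightarrow> 0"
    unfolding \<delta>_def N_def using m_pos by simp real_asymp
  then have small: "\<forall>\<^sub>F k in sequentially. real m * \<delta> k < 1/2"
    by (rule order_tendstoD) simp
  have summable: "summable (\<lambda>k. c * (1 / real k ^ 2))" for c :: real
    using inverse_power_summable[of 2, where 'a=real] by (intro summable_mult) (simp add: inverse_eq_divide)
  have small': "\<delta> k < 1/2" if "real m * \<delta> k < 1/2" for k
  proof -
    have "1 * \<delta> k \<le> real m * \<delta> k"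
      using m_pos \<delta>_nonneg by (intro mult_right_mono) auto
    then show ?thesis using that by simp
  qed
  have "AE \<omega> in M. (\<lambda>k. V k \<omega>) \<longlonglongrightarrow> 0"
  proof (rule AE_tendsto_zero_if_summable_expectation)
    show "\<forall>\<^sub>F k in sequentially. expectation (V k) \<le> (4 * t * real m) * (1 / real k ^ 2)"
      using small eventually_gt_at_top[of 0]
    proof eventually_elim
      case (elim k)
      have "expectation (V k) = expectation (\<lambda>\<omega>. (total_dev (\<delta> k) (k\<^sup>2) \<omega>)\<^sup>2) / (N k)\<^sup>2"
        unfolding V_def power_divide by simp
      also have "\<dots> \<le> 4 * \<delta> k * (real m) ^ 4 * (real (k\<^sup>2))\<^sup>2 / (N k)\<^sup>2"
        using elim
        by (intro divide_right_mono expectation_total_dev_sq_le \<delta>_nonneg small') auto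
      \<comment> \<open>Inserting \<open>\<delta> k = t / N k\<close> gives the denominator
        \<open>(N k)\<^sup>3\<close>, of order \<open>k\<^sup>6\<close>, against a numerator of
        order \<open>k\<^sup>4\<close>.\<close>
      also have "\<dots> = (4 * t * real m) * (1 / real k ^ 2)"
        using elim m_pos by (simp add: \<delta>_def N_def field_simps power2_eq_square power4_eq_xxxx)
      finally show ?case .
    qed
    show "integrable M (V k)" for k
      unfolding V_def power_divide by (intro integrable_divide integrable_total_dev_sq)
  qed (use summable in \<open>auto simp: V_def\<close>)
  moreover have "AE \<omega> in M. (\<lambda>k. W k \<omega>) \<longlonglongrightarrow> 0"
  proof (rule AE_tendsto_zero_if_summable_expectation)
    have int: "integrable M (\<lambda>\<omega>. near_pairs_within m (\<delta> k) (batch a \<omega>))" for k a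
      by (rule integrable_const_bound[where B="(real m)\<^sup>2"])
         (auto simp: near_pairs_within_bounds)
    show "integrable M (W k)" for k
      unfolding W_def using int by (intro integrable_divide Bochner_Integration.integrable_sum)
    show "\<forall>\<^sub>F k in sequentially. expectation (W k) \<le> (2 * (real m) * t) * (1 / real k ^ 2)"
      using small eventually_gt_at_top[of 0]
    proof eventually_elim
      case (elim k)
      have "expectation (W k) = (\<Sum>a<k\<^sup>2. expectation (\<lambda>\<omega>. near_pairs_within m (\<delta> k) (batch a \<omega>))) / N k"
        unfolding W_def using int by (simp add: Bochner_Integration.integral_sum)
      also have "\<dots> \<le> (\<Sum>a<k\<^sup>2. 2 * (real m) ^ 3 * \<delta> k) / N k"
        using expectation_near_pairs_within_le[OF \<delta>_nonneg small'] elim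
        by (intro divide_right_mono sum_mono) (auto simp: N_def)
      also have "\<dots> = (2 * (real m) * t) * (1 / real k ^ 2)"
        using elim m_pos by (simp add: \<delta>_def N_def field_simps power2_eq_square power3_eq_cube)
      finally show ?case .
    qed
  qed (use summable in \<open>auto simp: W_def N_def intro!: sum_nonneg divide_nonneg_nonneg near_pairs_within_bounds\<close>)
  ultimately show ?thesis
  proof eventually_elim
    case (elim \<omega>)
    \<comment> \<open>\<open>V\<close> is the square of the fluctuation, so its root is the absolute
      value.\<close>
    have "(\<lambda>k. sqrt (V k \<omega>)) \<longlonglongrightarrow> sqrt 0"
      using elim by (intro tendsto_real_sqrt)
    then have dev: "(\<lambda>k. total_dev (\<delta> k) (k\<^sup>2) \<omega> / N k) \<longlonglongrightarrow> 0"
      by (simp only: V_def real_sqrt_abs real_sqrt_zero tendsto_rabs_zero_iff)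
    \<comment> \<open>The factor \<open>1 - 1 / k\<^sup>2\<close> reflects the missing diagonal
      pairs of batches.\<close>
    have mean: "(\<lambda>k. 2 * t * (1 - 1 / real k ^ 2)) \<longlonglongrightarrow> 2 * t"
      by real_asymp
    have "(\<lambda>k. total_dev (\<delta> k) (k\<^sup>2) \<omega> / N k + 2 * t * (1 - 1 / real k ^ 2) + W k \<omega>) \<longlonglongrightarrow> 0 + 2 * t + 0"
      by (intro tendsto_add dev mean elim)
    moreover have "\<forall>\<^sub>F k in sequentially. total_dev (\<delta> k) (k\<^sup>2) \<omega> / N k + 2 * t * (1 - 1 / real k ^ 2) + W k \<omega> =
        real (pair_count (\<lambda>n. X n \<omega>) (m * k\<^sup>2) (t / real (m * k\<^sup>2))) / real (m * k\<^sup>2)"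
      using eventually_gt_at_top[of 0]
    proof eventually_elim
      case (elim k)
      have "((real (k\<^sup>2))\<^sup>2 - real (k\<^sup>2)) * (2 * \<delta> k * (real m)\<^sup>2) / N k = 2 * t * (1 - 1 / real k ^ 2)"
        using elim m_pos by (simp add: \<delta>_def N_def field_simps power2_eq_square)
      then show ?case
        unfolding N_def[symmetric] \<delta>_def[symmetric] pair_count_eq_total_dev W_def
        by (simp only: add_divide_distrib)
    qed
    ultimately show ?case
      by (simp add: tendsto_cong)
  qed
qed

text \<open>The exceptional null set depends on \<open>t\<close>; restricting to the countably many
  positive rationals leaves a single null set.\<close>

lemma AE_poissonian_pair_correlations: "AE \<omega> in M. poissonian_pair_correlations (\<lambda>n. X n \<omega>)"
proof -
  have "AE \<omega> in M. \<forall>t\<in>{t \<in> \<rat>. t > 0}.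
      (\<lambda>k. real (pair_count (\<lambda>n. X n \<omega>) (m * k\<^sup>2) (t / real (m * k\<^sup>2))) / real (m * k\<^sup>2)) \<longlonglongrightarrow> 2 * t"
    by (subst AE_ball_countable)
       (use AE_pair_count_tendsto in \<open>auto intro: countable_subset[OF _ countable_rat] simp del: of_nat_mult of_nat_power\<close>)
  then show ?thesis
    by eventually_elim (rule poissonian_pair_correlations_subseq[OF m_pos], auto)
qed

end

theorem theorem1p3:
  fixes P :: "'a measure" and M :: nat and X :: "nat \<Rightarrow> 'a \<Rightarrow> real"
  assumes "prob_space P"
    and "M \<ge> 1"
    and "batch_jittered_sequence P M X"
  shows "AE \<omega> in P. poissonian_pair_correlations (\<lambda>n. X n \<omega>)"
proof -
  interpret batch_jittered P M X
    using assms by (auto simp: batch_jittered_def batch_jittered_axioms_def)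
  show ?thesis by (rule AE_poissonian_pair_correlations)
qed

end
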